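(* The subTuring degrees are dense: if $g,f\colon\subseteq\omega\to\omega$ are partial functions with $g<_{\rm subT} f$, then there is a partial function $h$ with $g<_{\rm subT} h<_{\rm subT} f$.
   Context: For a partial computable function $\Phi$ from finite sequences of natural numbers to $\{0,1\}\times\omega$ and a partial function $g\colon\subseteq\omega\to\omega$, the $g$-relative sequential computation $\Phi[g]$ is defined as follows. On input $n$, with oracle answers $a_0,\dots,a_{s-1}$ obtained so far: if $\Phi(n,a_0,\dots,a_{s-1})$ is undefined, $\Phi[g](n)$ is undefined; if it equals $\langle 1,q\rangle$ the computation halts with output $q$; if it equals $\langle 0,q\rangle$, $q$ is a query, and if $q\in{\rm dom}(g)$ the computation continues with $a_s=g(q)$, while if $q\notin{\rm dom}(g)$ the computation never halts. For partial $f,g$, $f\leq_{\rm subT} g$ means there is such $\Phi$ with $f\subseteq\Phi[g]$ (for every $n\in{\rm dom}(f)$, $\Phi[g](n)$ is defined and equals $f(n)$). $f<_{\rm subT} g$ means $f\leq_{\rm subT} g$ and $g\not\leq_{\rm subT} f$. *)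

theory Defs
  imports Main "HOL-Library.Nat_Bijection"
begin

text \<open>Kleene's \<open>\<mu>\<close>-recursive functions. Programs carry no arity; \<open>rec_eval p xs = None\<close> means
  that \<open>p\<close> diverges on \<open>xs\<close>, in particular when \<open>xs\<close> has a length that does not suit \<open>p\<close>.
  \<open>Prec\<close> recurses on the first argument and \<open>Mu\<close> searches over the first argument of its
  operand; the search diverges if the operand does so before the first zero.\<close>

datatype recf =
    Zero
  | Succ
  | Proj nat
  | Comp recf "recf list"
  | Prec recf recf
  | Mu recf

fun rec_eval :: "recf \<Rightarrow> nat list \<Rightarrow> nat option" where
  "rec_eval Zero xs = Some 0"
| "rec_eval Succ xs = (case xs of [x] \<Rightarrow> Some (Suc x) | _ \<Rightarrow> None)"
| "rec_eval (Proj i) xs = (if i < length xs then Some (xs ! i) else None)"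
| "rec_eval (Comp p qs) xs =
    (case those (map (\<lambda>q. rec_eval q xs) qs) of None \<Rightarrow> None | Some ys \<Rightarrow> rec_eval p ys)"
| "rec_eval (Prec p q) xs =
    (case xs of
      [] \<Rightarrow> None
    | n # ys \<Rightarrow>
        rec_nat (rec_eval p ys)
          (\<lambda>k r. case r of None \<Rightarrow> None | Some y \<Rightarrow> rec_eval q (k # y # ys)) n)"
| "rec_eval (Mu p) xs =
    (if \<exists>n. rec_eval p (n # xs) = Some 0 \<and> (\<forall>k<n. rec_eval p (k # xs) \<noteq> None)
     then Some (LEAST n. rec_eval p (n # xs) = Some 0)
     else None)"

definition partial_computable :: "(nat \<rightharpoonup> nat) \<Rightarrow> bool" where
  "partial_computable \<phi> \<longleftrightarrow> (\<exists>p. \<forall>x. \<phi> x = rec_eval p [x])"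

text \<open>Partial functions from finite sequences to \<open>{0,1} \<times> \<omega>\<close>, with \<open>0\<close> and \<open>1\<close> represented
  by \<^const>\<open>False\<close> and \<^const>\<open>True\<close>.
  Every natural number is the code of exactly one sequence.\<close>

definition seq_computable :: "(nat list \<rightharpoonup> bool \<times> nat) \<Rightarrow> bool" where
  "seq_computable \<Phi> \<longleftrightarrow>
    (\<exists>\<phi>. partial_computable \<phi> \<and>
      (\<forall>\<sigma>. \<phi> (list_encode \<sigma>) = map_option (\<lambda>(b, q). prod_encode (of_bool b, q)) (\<Phi> \<sigma>)))"

text \<open>The computation from the state \<open>\<sigma> = [n, a\<^sub>0, \<dots>, a\<^sub>s\<^sub>-\<^sub>1]\<close>. The least fixed point in the
  flat order on options makes infinite runs undefined.\<close>

partial_function (option) seq_run ::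
    "(nat list \<rightharpoonup> bool \<times> nat) \<Rightarrow> (nat \<rightharpoonup> nat) \<Rightarrow> nat list \<rightharpoonup> nat" where
  "seq_run \<Phi> g \<sigma> =
    (case \<Phi> \<sigma> of
      None \<Rightarrow> None
    | Some (b, q) \<Rightarrow>
        if b then Some q
        else (case g q of None \<Rightarrow> None | Some a \<Rightarrow> seq_run \<Phi> g (\<sigma> @ [a])))"

definition seq_comp :: "(nat list \<rightharpoonup> bool \<times> nat) \<Rightarrow> (nat \<rightharpoonup> nat) \<Rightarrow> (nat \<rightharpoonup> nat)" where
  "seq_comp \<Phi> g n = seq_run \<Phi> g [n]"

definition subT_le :: "(nat \<rightharpoonup> nat) \<Rightarrow> (nat \<rightharpoonup> nat) \<Rightarrow> bool"
    (infix "\<le>\<^sub>s\<^sub>u\<^sub>b\<^sub>T" 50) where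
  "f \<le>\<^sub>s\<^sub>u\<^sub>b\<^sub>T g \<longleftrightarrow> (\<exists>\<Phi>. seq_computable \<Phi> \<and> f \<subseteq>\<^sub>m seq_comp \<Phi> g)"

definition subT_less :: "(nat \<rightharpoonup> nat) \<Rightarrow> (nat \<rightharpoonup> nat) \<Rightarrow> bool"
    (infix "<\<^sub>s\<^sub>u\<^sub>b\<^sub>T" 50) where
  "f <\<^sub>s\<^sub>u\<^sub>b\<^sub>T g \<longleftrightarrow> f \<le>\<^sub>s\<^sub>u\<^sub>b\<^sub>T g \<and> \<not> g \<le>\<^sub>s\<^sub>u\<^sub>b\<^sub>T f"

end

theory Submission
  imports Defs "HOL-Library.Countable_Set"
begin

text \<open>A restriction \<open>f |` D\<close> is reducible to \<open>f\<close> for every set \<open>D\<close>, however complicated, so the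
  intermediate degree can be sought as the join of \<open>g\<close> and \<open>f |` D\<close>. The set \<open>D\<close> is built from finite
  conditions that put some points into \<open>D\<close> and keep others out. Since \<open>f\<close> is not reducible to \<open>g\<close>
  even after finitely many changes, a point where a given \<open>\<Phi>\<close> fails to compute \<open>f\<close> from \<open>g\<close> can be
  put into \<open>D\<close>. To prevent \<open>\<Phi>\<close> from computing \<open>f\<close> from the join, take an argument where it fails
  with only the finitely many points admitted so far; if it succeeds with all points that may still
  be admitted, then it asks a question at an undecided point, and that point is kept out of \<open>D\<close>.\<close>

section \<open>Partial computable functions\<close>

abbreviation pfst :: "nat \<Rightarrow> nat" where "pfst z \<equiv> fst (prod_decode z)"
abbreviation psnd :: "nat \<Rightarrow> nat" where "psnd z \<equiv> snd (prod_decode z)"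

definition total_computable :: "(nat \<Rightarrow> nat) \<Rightarrow> bool" where
  "total_computable E \<longleftrightarrow> partial_computable (\<lambda>x. Some (E x))"

lemma total_computableI: "(\<And>x. rec_eval p [x] = Some (E x)) \<Longrightarrow> total_computable E"
  unfolding total_computable_def partial_computable_def by metis

lemma total_computableE:
  assumes "total_computable E"
  obtains p where "\<And>x. rec_eval p [x] = Some (E x)"
  using assms unfolding total_computable_def partial_computable_def by metis

lemma partial_computableI: "(\<And>x. rec_eval p [x] = F x) \<Longrightarrow> partial_computable F"
  unfolding partial_computable_def by metis

lemma partial_computableE:
  assumes "partial_computable F"
  obtains p where "\<And>x. rec_eval p [x] = F x"
  using assms unfolding partial_computable_def by metis

section \<open>Arithmetic, a conditional and the Cantor pairing as explicit programs\<close>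

fun recf_const :: "nat \<Rightarrow> recf" where
  "recf_const 0 = Zero"
| "recf_const (Suc n) = Comp Succ [recf_const n]"

lemma recf_const [simp]: "rec_eval (recf_const n) xs = Some n"
  by (induction n) auto

definition "recf_add = Prec (Proj 0) (Comp Succ [Proj 1])"
definition "recf_pred = Prec Zero (Proj 0)"
text \<open>\<open>Prec\<close> recurses on its first argument, so the subtrahend comes first: on
  \<open>[m, n]\<close> the value is \<open>n - m\<close>.\<close>

definition "recf_sub = Prec (Proj 0) (Comp recf_pred [Proj 1])"
definition "recf_triangle = Prec Zero (Comp Succ [Comp recf_add [Proj 0, Proj 1]])"
definition "recf_pair = Comp recf_add [Comp recf_triangle [recf_add], Proj 0]"
text \<open>The step receives the counter, the previous value, \<open>a\<close> and
  \<open>b\<close>; \<open>Proj 3\<close> forgets the recursion and returns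
  \<open>b\<close>.\<close>

definition "recf_if = Prec (Proj 0) (Proj 3)"

lemma recf_add [simp]: "rec_eval recf_add [m, n] = Some (m + n)"
  unfolding recf_add_def by (induction m) auto

lemma recf_pred [simp]: "rec_eval recf_pred [n] = Some (n - 1)"
  unfolding recf_pred_def by (induction n) auto

lemma recf_sub [simp]: "rec_eval recf_sub [m, n] = Some (n - m)"
  unfolding recf_sub_def by (induction m) auto

lemma recf_triangle [simp]: "rec_eval recf_triangle [n] = Some (triangle n)"
  unfolding recf_triangle_def by (induction n) auto

lemma recf_pair [simp]: "rec_eval recf_pair [m, n] = Some (prod_encode (m, n))"
  unfolding recf_pair_def by (simp add: prod_encode_def)

lemma recf_if [simp]: "rec_eval recf_if [c, a, b] = Some (if c = 0 then a else b)"
proof -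
  have "rec_eval recf_if [c, a, b] = Some (case c of 0 \<Rightarrow> a | Suc _ \<Rightarrow> b)"
    unfolding recf_if_def by (induction c) (auto split: nat.splits)
  then show ?thesis by (cases c) auto
qed

lemma triangle_mono: "m \<le> n \<Longrightarrow> triangle m \<le> triangle n"
  by (induction n rule: dec_induct) auto

lemma code_eq_triangle: "z = triangle (pfst z + psnd z) + pfst z"
  using prod_decode_inverse [of z] by (simp add: prod_encode_def case_prod_beta)

text \<open>The antidiagonal of a code \<open>z\<close> is the least \<open>s\<close> with \<open>z < triangle (Suc s)\<close>.\<close>

definition "recf_diag = Mu (Comp recf_sub [Comp recf_triangle [Comp Succ [Proj 0]], Comp Succ [Proj 1]])"
definition "recf_fst = Comp recf_sub [Comp recf_triangle [recf_diag], Proj 0]"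
definition "recf_snd = Comp recf_sub [recf_fst, recf_diag]"

lemma recf_diag [simp]: "rec_eval recf_diag [z] = Some (pfst z + psnd z)"
proof -
  obtain m n where mn: "prod_decode z = (m, n)" by force
  then have z: "z = triangle (m + n) + m"
    using code_eq_triangle [of z] by simp
  have lt: "Suc z - triangle (Suc s) = 0 \<longleftrightarrow> m + n \<le> s" for s
  proof
    assume "m + n \<le> s"
    then have "triangle (Suc (m + n)) \<le> triangle (Suc s)" by (intro triangle_mono) simp
    then show "Suc z - triangle (Suc s) = 0" by (simp add: z)
  next
    assume *: "Suc z - triangle (Suc s) = 0"
    show "m + n \<le> s"
    proof (rule ccontr)
      assume "\<not> m + n \<le> s"
      then have "triangle (Suc s) \<le> triangle (m + n)" by (intro triangle_mono) simp
      then show False using * by (simp add: z)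
    qed
  qed
  have "(LEAST s. Suc z - triangle (Suc s) = 0) = m + n"
    unfolding lt by (rule Least_equality) auto
  moreover have "\<exists>s. Suc z - triangle (Suc s) = 0" using lt by blast
  ultimately show ?thesis unfolding recf_diag_def by (simp add: mn del: triangle_Suc)
qed

lemma recf_fst [simp]: "rec_eval recf_fst [z] = Some (pfst z)"
proof -
  obtain m n where mn: "prod_decode z = (m, n)" by force
  then have z: "z = triangle (m + n) + m"
    using code_eq_triangle [of z] by simp
  show ?thesis unfolding recf_fst_def by (simp add: mn) (simp add: z)
qed

lemma recf_snd [simp]: "rec_eval recf_snd [z] = Some (psnd z)"
  unfolding recf_snd_def by simp

section \<open>Closure properties of the computable functions\<close>

named_theorems computable

lemma total_computable_comp1:
  assumes "\<And>m. rec_eval p [m] = Some (F m)" "total_computable A"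
  shows "total_computable (\<lambda>x. F (A x))"
proof -
  obtain a where "\<And>x. rec_eval a [x] = Some (A x)" using assms(2) by (rule total_computableE) blast
  then show ?thesis by (intro total_computableI [of "Comp p [a]"]) (simp add: assms)
qed

lemma total_computable_comp2:
  assumes "\<And>m n. rec_eval p [m, n] = Some (F m n)" "total_computable A" "total_computable B"
  shows "total_computable (\<lambda>x. F (A x) (B x))"
proof -
  obtain a where "\<And>x. rec_eval a [x] = Some (A x)" using assms(2) by (rule total_computableE) blast
  moreover obtain b where "\<And>x. rec_eval b [x] = Some (B x)" using assms(3) by (rule total_computableE) blast
  ultimately show ?thesis by (intro total_computableI [of "Comp p [a, b]"]) (simp add: assms)
qed

lemma total_computable_id [computable]: "total_computable (\<lambda>x. x)"
  by (rule total_computableI [of "Proj 0"]) simp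

lemma total_computable_const [computable]: "total_computable (\<lambda>x. c)"
  by (rule total_computableI [of "recf_const c"]) simp

lemma total_computable_Suc [computable]:
  "total_computable A \<Longrightarrow> total_computable (\<lambda>x. Suc (A x))"
  by (rule total_computable_comp1 [of Succ]) auto

lemma total_computable_pfst [computable]:
  "total_computable A \<Longrightarrow> total_computable (\<lambda>x. pfst (A x))"
  by (rule total_computable_comp1 [of recf_fst]) auto

lemma total_computable_psnd [computable]:
  "total_computable A \<Longrightarrow> total_computable (\<lambda>x. psnd (A x))"
  by (rule total_computable_comp1 [of recf_snd]) auto

lemma total_computable_diff [computable]:
  "total_computable A \<Longrightarrow> total_computable B \<Longrightarrow> total_computable (\<lambda>x. A x - B x)"
  by (rule total_computable_comp2 [of recf_sub "\<lambda>m n. n - m"]) auto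

lemma total_computable_add [computable]:
  "total_computable A \<Longrightarrow> total_computable B \<Longrightarrow> total_computable (\<lambda>x. A x + B x)"
  by (rule total_computable_comp2 [of recf_add]) auto

lemma total_computable_pair [computable]:
  "total_computable A \<Longrightarrow> total_computable B \<Longrightarrow> total_computable (\<lambda>x. prod_encode (A x, B x))"
  by (rule total_computable_comp2 [of recf_pair]) auto

lemma partial_computable_Some [computable]:
  "total_computable A \<Longrightarrow> partial_computable (\<lambda>x. Some (A x))"
  by (simp add: total_computable_def)

lemma partial_computable_app:
  assumes "partial_computable F" "total_computable A"
  shows "partial_computable (\<lambda>x. F (A x))"
proof -
  obtain f where "\<And>x. rec_eval f [x] = F x" using assms(1) by (rule partial_computableE) blast
  moreover obtain a where "\<And>x. rec_eval a [x] = Some (A x)" using assms(2) by (rule total_computableE) blast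
  ultimately show ?thesis by (intro partial_computableI [of "Comp f [a]"]) simp
qed

lemma total_computable_app:
  "total_computable F \<Longrightarrow> total_computable A \<Longrightarrow> total_computable (\<lambda>x. F (A x))"
  unfolding total_computable_def
  by (rule partial_computable_app [of "\<lambda>x. Some (F x)"]) (simp_all add: total_computable_def)

text \<open>The continuation may use the original input as well as the intermediate value; pairing
  the two turns it into a unary function.\<close>

lemma partial_computable_bind [computable]:
  assumes "partial_computable A" "partial_computable (\<lambda>z. B (pfst z) (psnd z))"
  shows "partial_computable (\<lambda>x. Option.bind (A x) (B x))"
proof -
  obtain a where "\<And>x. rec_eval a [x] = A x" using assms(1) by (rule partial_computableE) blast
  moreover obtain b where "\<And>z. rec_eval b [z] = B (pfst z) (psnd z)"
    using assms(2) by (rule partial_computableE) blast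
  ultimately show ?thesis
    by (intro partial_computableI [of "Comp b [Comp recf_pair [Proj 0, a]]"])
      (simp split: option.split)
qed

text \<open>Composition evaluates all its arguments, so a branch is protected against divergence by
  putting it into the step of a primitive recursion whose length is the condition.\<close>

lemma partial_computable_if [computable]:
  assumes "total_computable C" "partial_computable A" "partial_computable B"
  shows "partial_computable (\<lambda>x. if C x = 0 then A x else B x)"
proof -
  obtain c where c: "\<And>x. rec_eval c [x] = Some (C x)" using assms(1) by (rule total_computableE) blast
  obtain a where a: "\<And>x. rec_eval a [x] = A x" using assms(2) by (rule partial_computableE) blast
  obtain b where b: "\<And>x. rec_eval b [x] = B x" using assms(3) by (rule partial_computableE) blast
  define guard where "guard p = Prec Zero (Comp p [Proj 2])" for p
  have guard: "rec_eval (guard p) [n, x] = (if n = 0 then Some 0 else rec_eval p [x])" for p n x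
    unfolding guard_def by (induction n) (auto split: option.splits)
  \<comment> \<open>Exactly one of the lengths \<open>1 - C x\<close> and \<open>C x\<close> is
    positive, so only the chosen branch is run; the other guard yields the default 0, which
    \<open>recf_if\<close> ignores.\<close>
  show ?thesis
    by (rule partial_computableI [of "Comp recf_if [c,
          Comp (guard a) [Comp recf_sub [c, recf_const 1], Proj 0], Comp (guard b) [c, Proj 0]]"])
      (simp add: guard a b c split: option.split)
qed

lemma total_computable_if [computable]:
  assumes "total_computable C" "total_computable A" "total_computable B"
  shows "total_computable (\<lambda>x. if C x = 0 then A x else B x)"
  using partial_computable_if [OF assms(1) assms(2,3) [THEN partial_computable_Some]]
  by (simp add: total_computable_def if_distrib)

text \<open>While loops: \<open>\<theta>\<close> returns a next state tagged with \<open>0\<close> or a result tagged with a positive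
  number.\<close>

lemma partial_computable_loop:
  assumes "partial_computable \<theta>"
  obtains P where "partial_computable P"
    "\<And>s z. \<theta> s = Some z \<Longrightarrow> P s = (if pfst z = 0 then P (psnd z) else Some (psnd z))"
proof -
  define step where "step z = (if pfst z = 0 then \<theta> (psnd z) else Some z)" for z
  have "partial_computable step"
    unfolding step_def by (intro computable partial_computable_app [OF assms])
  then obtain st where st: "\<And>z. rec_eval st [z] = step z" by (rule partial_computableE) blast
  \<comment> \<open>\<open>J k w\<close> makes \<open>k\<close> steps from the tagged state
    \<open>w\<close>, and finished states stay put. The recursor adds steps at the end;
    \<open>J_Suc\<close> peels one off at the front, as the loop equation requires.\<close>
  define J where "J k w = rec_nat (Some w) (\<lambda>_ r. Option.bind r step) k" for k w
  have J_Suc: "J (Suc k) w = Option.bind (step w) (J k)" for k w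
    by (induction k) (auto simp: J_def)
  define it where "it = Prec (Comp recf_pair [Zero, Proj 0]) (Comp st [Proj 1])"
  have it: "rec_eval it [k, s] = J k (prod_encode (0, s))" for k s
    unfolding it_def J_def by (induction k) (auto simp: st split: option.split)
  \<comment> \<open>Since \<open>1 - t\<close> is zero iff the tag \<open>t\<close> is positive,
    this searches for the first finished stage.\<close>
  define mu where "mu = Mu (Comp recf_sub [Comp recf_fst [it], recf_const 1])"
  define P where "P s = rec_eval (Comp recf_snd [Comp it [mu, Proj 0]]) [s]" for s
  have stable: "J (i + k) w = Some v" if "J k w = Some v" "pfst v \<noteq> 0" for i k w v
    using that by (induction i) (auto simp: J_def step_def)
  have P: "P s = Some r \<longleftrightarrow> (\<exists>k w. J k (prod_encode (0, s)) = Some w \<and> pfst w \<noteq> 0 \<and> psnd w = r)"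
    (is "_ \<longleftrightarrow> ?R") for s r
  proof -
    let ?J = "\<lambda>k. J k (prod_encode (0, s))"
    define m where "m k = rec_eval (Comp recf_sub [Comp recf_fst [it], recf_const 1]) [k, s]" for k
    have m0: "m k = Some 0 \<longleftrightarrow> (\<exists>w. ?J k = Some w \<and> pfst w \<noteq> 0)" for k
      unfolding m_def by (cases "?J k") (auto simp: it)
    have mN: "m k = None \<longleftrightarrow> ?J k = None" for k
      unfolding m_def by (cases "?J k") (auto simp: it)
    have none: "?J (i + k) = None" if "?J k = None" for i k
      using that by (induction i) (auto simp: J_def)
    \<comment> \<open>A divergent iteration stays divergent, so the condition that \<open>Mu\<close>
      puts on earlier values holds automatically.\<close>
    have ex: "(\<exists>n. m n = Some 0 \<and> (\<forall>k<n. m k \<noteq> None)) \<longleftrightarrow> (\<exists>n. m n = Some 0)"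
    proof (rule iffI; elim exE conjE)
      fix n assume n: "m n = Some 0"
      have "m k \<noteq> None" if "k < n" for k
      proof
        assume "m k = None"
        then have "?J (n - k + k) = None" unfolding mN by (rule none)
        then show False using that n mN [of n] by simp
      qed
      with n show "\<exists>n. m n = Some 0 \<and> (\<forall>k<n. m k \<noteq> None)" by blast
    qed blast
    define k0 where "k0 = (LEAST n. m n = Some 0)"
    have "rec_eval mu [s] = (if \<exists>n. m n = Some 0 \<and> (\<forall>k<n. m k \<noteq> None)
        then Some (LEAST n. m n = Some 0) else None)"
      unfolding mu_def m_def by (rule rec_eval.simps)
    then have mu: "rec_eval mu [s] = (if \<exists>n. m n = Some 0 then Some k0 else None)"
      unfolding ex k0_def .
    show ?thesis
    proof (cases "\<exists>n. m n = Some 0")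
      case True
      then have "m k0 = Some 0" unfolding k0_def by (rule LeastI_ex)
      then obtain w where w: "?J k0 = Some w" "pfst w \<noteq> 0" unfolding m0 by blast
      have Ps: "P s = Some (psnd w)" using mu True w by (simp add: P_def it)
      have "w' = w" if "?J k = Some w'" "pfst w' \<noteq> 0" for k w'
        using stable [OF w, of k] stable [OF that, of k0] by (simp add: add.commute)
      then show ?thesis unfolding Ps using w by (metis option.inject)
    next
      case False
      then have "P s = None" using mu by (simp add: P_def)
      then show ?thesis using False unfolding m0 by auto
    qed
  qed
  have "P s = (if pfst z = 0 then P (psnd z) else Some (psnd z))" if "\<theta> s = Some z" for s z
  proof -
    have Suc: "J (Suc k) (prod_encode (0, s)) = J k z" for k
      by (simp add: J_Suc step_def that)
    have shift: "(\<exists>k w. J k (prod_encode (0, s)) = Some w \<and> pfst w \<noteq> 0 \<and> psnd w = r) \<longleftrightarrow>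
        (\<exists>k w. J k z = Some w \<and> pfst w \<noteq> 0 \<and> psnd w = r)" (is "?L \<longleftrightarrow> ?R") for r
    proof
      assume ?L
      then obtain k w where k: "J k (prod_encode (0, s)) = Some w" "pfst w \<noteq> 0" "psnd w = r" by blast
      \<comment> \<open>Stage 0 is the start state itself, whose tag is 0.\<close>
      then have "k \<noteq> 0" by (intro notI) (auto simp: J_def)
      then obtain k' where "k = Suc k'" by (cases k) auto
      with k Suc show ?R by auto
    next
      assume ?R then show ?L using Suc by metis
    qed
    show ?thesis
    proof (cases "pfst z = 0")
      case True
      then have z: "prod_encode (0, psnd z) = z"
        by (metis prod.collapse prod_decode_inverse)
      have "P s = Some r \<longleftrightarrow> P (psnd z) = Some r" for r
        unfolding P shift z by (rule refl)
      then show ?thesis using True by (metis option.exhaust)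
    next
      case False
      have "J 0 z = Some z" by (simp add: J_def)
      with False have "P s = Some (psnd z)" unfolding P shift by blast
      with False show ?thesis by simp
    qed
  qed
  moreover have "partial_computable P" unfolding P_def by (rule partial_computableI) (rule refl)
  ultimately show ?thesis using that by blast
qed


section \<open>Codes of lists\<close>

lemma list_encode_eq_0_iff: "list_encode xs = 0 \<longleftrightarrow> xs = []"
  by (cases xs) simp_all

text \<open>A loop moves heads from one list to the other. Reversal onto an accumulator is the only
  list operation that needs a loop here; appending an element applies it twice.\<close>

lemma total_computable_rev_append:
  assumes "total_computable A" "total_computable B"
  shows "total_computable (\<lambda>x. list_encode (rev (list_decode (A x)) @ list_decode (B x)))"
proof -
  \<comment> \<open>The state pairs the code of the remaining list with that of the accumulator. The
    code of \<open>x # xs\<close> is the successor of a pair, hence the \<open>- 1\<close>, and 0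
    codes \<open>[]\<close>.\<close>
  let ?\<theta> = "\<lambda>s. Some (if pfst s = 0 then prod_encode (1, psnd s) else
    prod_encode (0, prod_encode (psnd (pfst s - 1),
      Suc (prod_encode (pfst (pfst s - 1), psnd s)))))"
  have "partial_computable ?\<theta>" by (intro computable)
  then obtain P where P: "partial_computable P"
    "\<And>s z. ?\<theta> s = Some z \<Longrightarrow> P s = (if pfst z = 0 then P (psnd z) else Some (psnd z))"
    by (rule partial_computable_loop) blast
  have loop: "P (prod_encode (list_encode xs, list_encode ys)) = Some (list_encode (rev xs @ ys))"
    for xs ys
  proof (induction xs arbitrary: ys)
    case Nil
    show ?case by (subst P(2) [OF refl]) simp
  next
    case (Cons x xs)
    show ?case using Cons [of "x # ys"] by (subst P(2) [OF refl]) simp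
  qed
  have "partial_computable (\<lambda>x. P (prod_encode (A x, B x)))"
    by (intro partial_computable_app [OF P(1)] computable assms)
  also have "(\<lambda>x. P (prod_encode (A x, B x))) =
      (\<lambda>x. Some (list_encode (rev (list_decode (A x)) @ list_decode (B x))))"
    using loop [of "list_decode (A x)" "list_decode (B x)" for x] by simp
  finally show ?thesis by (simp add: total_computable_def)
qed

lemma total_computable_snoc [computable]:
  assumes "total_computable A" "total_computable B"
  shows "total_computable (\<lambda>x. list_encode (list_decode (A x) @ [B x]))"
proof -
  \<comment> \<open>The first reversal goes onto \<open>[]\<close>; reversing its result onto
    \<open>[B x]\<close> restores the order.\<close>
  have "total_computable (\<lambda>x. list_encode (rev (list_decode (A x)) @ list_decode 0))"
    by (rule total_computable_rev_append [OF assms(1) total_computable_const])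
  moreover have "total_computable (\<lambda>x. Suc (prod_encode (B x, 0)))"
    by (intro computable assms(2))
  ultimately show ?thesis
    using total_computable_rev_append by fastforce
qed

section \<open>Sequential computations\<close>

text \<open>Programs are easier to write if any nonzero tag may signal halting; the proof normalises
  the tags to 0 and 1.\<close>

lemma seq_computableI:
  assumes "partial_computable \<psi>"
    "\<And>\<sigma>. \<Phi> \<sigma> = map_option (\<lambda>z. (pfst z \<noteq> 0, psnd z)) (\<psi> (list_encode \<sigma>))"
  shows "seq_computable \<Phi>"
  unfolding seq_computable_def
proof (intro exI conjI allI)
  let ?\<phi> = "\<lambda>x. Option.bind (\<psi> x) (\<lambda>z. Some (prod_encode (if pfst z = 0 then 0 else 1, psnd z)))"
  show "partial_computable ?\<phi>"
    by (intro computable assms(1))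
  show "?\<phi> (list_encode \<sigma>) = map_option (\<lambda>(b, q). prod_encode (of_bool b, q)) (\<Phi> \<sigma>)" for \<sigma>
    by (cases "\<psi> (list_encode \<sigma>)") (simp_all add: assms(2))
qed

lemma seq_computableE:
  assumes "seq_computable \<Phi>"
  obtains \<phi> where "partial_computable \<phi>"
    "\<And>\<sigma>. \<phi> (list_encode \<sigma>) = map_option (\<lambda>(b, q). prod_encode (of_bool b, q)) (\<Phi> \<sigma>)"
    "\<And>\<sigma>. \<Phi> \<sigma> = map_option (\<lambda>z. (pfst z \<noteq> 0, psnd z)) (\<phi> (list_encode \<sigma>))"
proof -
  obtain \<phi> where \<phi>: "partial_computable \<phi>"
    "\<And>\<sigma>. \<phi> (list_encode \<sigma>) = map_option (\<lambda>(b, q). prod_encode (of_bool b, q)) (\<Phi> \<sigma>)"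
    using assms unfolding seq_computable_def by blast
  moreover have "\<Phi> \<sigma> = map_option (\<lambda>z. (pfst z \<noteq> 0, psnd z)) (\<phi> (list_encode \<sigma>))" for \<sigma>
    by (cases "\<Phi> \<sigma>") (auto simp: \<phi>(2))
  ultimately show ?thesis by (rule that)
qed

instance recf :: countable
  by countable_datatype

text \<open>Each such function is decoded from a program, and programs form a countable datatype.
  The resulting enumeration supplies the stages of \<open>generic_restriction\<close>.\<close>

lemma countable_seq_computable: "countable {\<Phi>. seq_computable \<Phi>}"
proof (rule countable_subset)
  let ?D = "\<lambda>p \<sigma>. map_option (\<lambda>z. (pfst z \<noteq> 0, psnd z)) (rec_eval p [list_encode \<sigma>])"
  show "{\<Phi>. seq_computable \<Phi>} \<subseteq> range ?D"
  proof clarify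
    fix \<Phi> assume "seq_computable \<Phi>"
    then obtain \<phi> where \<phi>: "partial_computable \<phi>"
      "\<And>\<sigma>. \<Phi> \<sigma> = map_option (\<lambda>z. (pfst z \<noteq> 0, psnd z)) (\<phi> (list_encode \<sigma>))"
      by (rule seq_computableE) blast
    obtain p where "\<And>x. rec_eval p [x] = \<phi> x" using \<phi>(1) by (rule partial_computableE) blast
    then have "\<Phi> = ?D p" using \<phi>(2) by auto
    then show "\<Phi> \<in> range ?D" by blast
  qed
qed simp

text \<open>Terminating runs as finite derivations, so that proofs go by induction along a run
  instead of through the least fixed point.\<close>

inductive halts :: "(nat list \<rightharpoonup> bool \<times> nat) \<Rightarrow> (nat \<rightharpoonup> nat) \<Rightarrow> nat list \<Rightarrow> nat \<Rightarrow> bool"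
  for \<Phi> g where
  answer: "\<Phi> \<sigma> = Some (True, y) \<Longrightarrow> halts \<Phi> g \<sigma> y"
| query: "\<Phi> \<sigma> = Some (False, q) \<Longrightarrow> g q = Some a \<Longrightarrow> halts \<Phi> g (\<sigma> @ [a]) y \<Longrightarrow> halts \<Phi> g \<sigma> y"

lemma seq_run_eq_Some_iff: "seq_run \<Phi> g \<sigma> = Some y \<longleftrightarrow> halts \<Phi> g \<sigma> y"
proof
  show "halts \<Phi> g \<sigma> y" if "seq_run \<Phi> g \<sigma> = Some y"
  proof (rule seq_run.raw_induct [OF _ that])
    fix run \<Phi> g \<sigma> y
    assume "\<And>\<Phi> g \<sigma> y. run \<Phi> g \<sigma> = Some y \<Longrightarrow> halts \<Phi> g \<sigma> y"
      "(case \<Phi> \<sigma> of None \<Rightarrow> None | Some (b, q) \<Rightarrow> if b then Some q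
        else case g q of None \<Rightarrow> None | Some a \<Rightarrow> run \<Phi> g (\<sigma> @ [a])) = Some y"
    then show "halts \<Phi> g \<sigma> y"
      by (auto split: option.splits prod.splits if_splits intro: halts.intros)
  qed
  show "seq_run \<Phi> g \<sigma> = Some y" if "halts \<Phi> g \<sigma> y"
    using that by induction (simp_all add: seq_run.simps)
qed

lemma map_le_seq_comp_iff: "f \<subseteq>\<^sub>m seq_comp \<Phi> g \<longleftrightarrow> (\<forall>n y. f n = Some y \<longrightarrow> halts \<Phi> g [n] y)"
  unfolding seq_comp_def map_le_def dom_def seq_run_eq_Some_iff [symmetric] by fastforce

lemma halts_mono: "halts \<Phi> g \<sigma> y \<Longrightarrow> g \<subseteq>\<^sub>m h \<Longrightarrow> halts \<Phi> h \<sigma> y"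
  by (induction rule: halts.induct) (auto simp: map_le_def dom_def intro: halts.intros)

text \<open>A run consults its program only at extensions of the start state. This lets a new
  program imitate an old one from a different input.\<close>

lemma halts_transfer:
  assumes "halts \<Phi> g \<sigma> y" "\<And>zs. \<Phi>' (\<sigma>' @ zs) = \<Phi> (\<sigma> @ zs)"
  shows "halts \<Phi>' g \<sigma>' y"
  using assms
proof (induction arbitrary: \<sigma>' rule: halts.induct)
  case (answer \<sigma> y)
  then show ?case using answer.prems [of "[]"] by (auto intro: halts.answer)
next
  case (query \<sigma> q a y)
  have "halts \<Phi>' g (\<sigma>' @ [a]) y" by (rule query.IH) (simp add: query.prems)
  then show ?case using query.hyps query.prems [of "[]"] by (auto intro: halts.query)
qed

lemma halts_queryD:
  assumes "halts \<Phi> g \<sigma> y" "\<Phi> \<sigma> = Some (False, q)"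
  obtains a where "g q = Some a" "halts \<Phi> g (\<sigma> @ [a]) y"
  using assms by (auto elim: halts.cases)

section \<open>SubTuring reducibility\<close>

lemma subT_leI:
  assumes "seq_computable \<Phi>" "\<And>n y. f n = Some y \<Longrightarrow> halts \<Phi> g [n] y"
  shows "f \<le>\<^sub>s\<^sub>u\<^sub>b\<^sub>T g"
  using assms unfolding subT_le_def map_le_seq_comp_iff by blast

lemma subT_leE:
  assumes "f \<le>\<^sub>s\<^sub>u\<^sub>b\<^sub>T g"
  obtains \<Phi> where "seq_computable \<Phi>" "\<And>n y. f n = Some y \<Longrightarrow> halts \<Phi> g [n] y"
  using assms unfolding subT_le_def map_le_seq_comp_iff by blast

lemma subT_le_if_many_one:
  assumes "total_computable \<alpha>" "\<And>n y. f n = Some y \<Longrightarrow> g (\<alpha> n) = Some y"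
  shows "f \<le>\<^sub>s\<^sub>u\<^sub>b\<^sub>T g"
proof (rule subT_leI)
  \<comment> \<open>For a state \<open>n # as\<close>, \<open>x - 1\<close> pairs \<open>n\<close>
    with the code of \<open>as\<close>; that code is 0 as long as the single query is unanswered,
    and afterwards its first entry is the output.\<close>
  let ?\<psi> = "\<lambda>x. Some (if psnd (x - 1) = 0 then prod_encode (0, \<alpha> (pfst (x - 1)))
    else prod_encode (1, pfst (psnd (x - 1) - 1)))"
  let ?\<Phi> = "\<lambda>\<sigma>. map_option (\<lambda>z. (pfst z \<noteq> 0, psnd z)) (?\<psi> (list_encode \<sigma>))"
  show "seq_computable ?\<Phi>"
  proof (rule seq_computableI [OF _ refl])
    show "partial_computable ?\<psi>"
      by (intro computable total_computable_app [OF assms(1)])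
  qed
  show "halts ?\<Phi> g [n] y" if "f n = Some y" for n y
  proof (rule halts.query)
    show "g (\<alpha> n) = Some y" using assms(2) that .
  qed (auto intro!: halts.answer)
qed

lemma subT_le_if_map_le: "f \<subseteq>\<^sub>m g \<Longrightarrow> f \<le>\<^sub>s\<^sub>u\<^sub>b\<^sub>T g"
  by (rule subT_le_if_many_one [OF total_computable_id]) (auto simp: map_le_def dom_def)

text \<open>The value \<open>v\<close> is hard-wired at input \<open>c\<close>; other inputs run the
  given reduction.\<close>

lemma subT_le_upd:
  assumes "f \<le>\<^sub>s\<^sub>u\<^sub>b\<^sub>T g"
  shows "f(c \<mapsto> v) \<le>\<^sub>s\<^sub>u\<^sub>b\<^sub>T g"
proof -
  obtain \<Phi> where \<Phi>: "seq_computable \<Phi>" "\<And>n y. f n = Some y \<Longrightarrow> halts \<Phi> g [n] y"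
    using assms by (rule subT_leE) blast
  obtain \<phi> where \<phi>: "partial_computable \<phi>"
    "\<And>\<sigma>. \<Phi> \<sigma> = map_option (\<lambda>z. (pfst z \<noteq> 0, psnd z)) (\<phi> (list_encode \<sigma>))"
    using \<Phi>(1) by (rule seq_computableE) blast
  \<comment> \<open>With truncated subtraction, the sum of both differences is 0 iff the input
    equals \<open>c\<close>.\<close>
  let ?\<psi> = "\<lambda>x. if (pfst (x - 1) - c) + (c - pfst (x - 1)) = 0
    then Some (prod_encode (1, v)) else \<phi> x"
  let ?\<Phi> = "\<lambda>\<sigma>. map_option (\<lambda>z. (pfst z \<noteq> 0, psnd z)) (?\<psi> (list_encode \<sigma>))"
  show ?thesis
  proof (rule subT_leI)
    show "seq_computable ?\<Phi>"
    proof (rule seq_computableI [OF _ refl])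
      show "partial_computable ?\<psi>" by (intro computable \<phi>(1))
    qed
    show "halts ?\<Phi> g [n] y" if y: "(f(c \<mapsto> v)) n = Some y" for n y
    proof (cases "n = c")
      case True
      with y show ?thesis by (intro halts.answer) simp
    next
      case False
      with y have "halts \<Phi> g [n] y" by (intro \<Phi>(2)) simp
      then show ?thesis
        by (rule halts_transfer) (use False \<phi>(2) in auto)
    qed
  qed
qed

text \<open>Every nonzero tag leads to \<open>f\<close>, so that one zero test decides the
  side.\<close>

definition join :: "(nat \<rightharpoonup> nat) \<Rightarrow> (nat \<rightharpoonup> nat) \<Rightarrow> (nat \<rightharpoonup> nat)" where
  "join g f z = (if pfst z = 0 then g (psnd z) else f (psnd z))"

lemma subT_le_join1: "g \<le>\<^sub>s\<^sub>u\<^sub>b\<^sub>T join g f"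
  by (rule subT_le_if_many_one [of "\<lambda>n. prod_encode (0, n)"]) (intro computable, simp add: join_def)

lemma subT_le_join2: "f \<le>\<^sub>s\<^sub>u\<^sub>b\<^sub>T join g f"
  by (rule subT_le_if_many_one [of "\<lambda>n. prod_encode (1, n)"]) (intro computable, simp add: join_def)

text \<open>The input remains the head of every state, so its tag tells at each step which reduction
  to continue.\<close>

lemma join_subT_le:
  assumes "g \<le>\<^sub>s\<^sub>u\<^sub>b\<^sub>T k" "f \<le>\<^sub>s\<^sub>u\<^sub>b\<^sub>T k"
  shows "join g f \<le>\<^sub>s\<^sub>u\<^sub>b\<^sub>T k"
proof -
  obtain \<Phi> where \<Phi>: "seq_computable \<Phi>" "\<And>n y. g n = Some y \<Longrightarrow> halts \<Phi> k [n] y"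
    using assms(1) by (rule subT_leE) blast
  obtain \<phi> where \<phi>: "partial_computable \<phi>"
    "\<And>\<sigma>. \<Phi> \<sigma> = map_option (\<lambda>z. (pfst z \<noteq> 0, psnd z)) (\<phi> (list_encode \<sigma>))"
    using \<Phi>(1) by (rule seq_computableE) blast
  obtain \<Psi> where \<Psi>: "seq_computable \<Psi>" "\<And>n y. f n = Some y \<Longrightarrow> halts \<Psi> k [n] y"
    using assms(2) by (rule subT_leE) blast
  obtain \<psi> where \<psi>: "partial_computable \<psi>"
    "\<And>\<sigma>. \<Psi> \<sigma> = map_option (\<lambda>z. (pfst z \<noteq> 0, psnd z)) (\<psi> (list_encode \<sigma>))"
    using \<Psi>(1) by (rule seq_computableE) blast
  \<comment> \<open>Strips the tag from the input and keeps the oracle answers.\<close>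
  let ?arg = "\<lambda>x. Suc (prod_encode (psnd (pfst (x - 1)), psnd (x - 1)))"
  let ?\<chi> = "\<lambda>x. if pfst (pfst (x - 1)) = 0 then \<phi> (?arg x) else \<psi> (?arg x)"
  let ?X = "\<lambda>\<sigma>. map_option (\<lambda>z. (pfst z \<noteq> 0, psnd z)) (?\<chi> (list_encode \<sigma>))"
  show ?thesis
  proof (rule subT_leI)
    show "seq_computable ?X"
    proof (rule seq_computableI [OF _ refl])
      show "partial_computable ?\<chi>"
        by (intro computable partial_computable_app [OF \<phi>(1)] partial_computable_app [OF \<psi>(1)])
    qed
    show "halts ?X k [n] y" if y: "join g f n = Some y" for n y
    proof (cases "pfst n = 0")
      case True
      with y have "halts \<Phi> k [psnd n] y" by (intro \<Phi>(2)) (simp add: join_def)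
      then show ?thesis
        by (rule halts_transfer)
          (use True \<phi>(2) in simp)
    next
      case False
      with y have "halts \<Psi> k [psnd n] y" by (intro \<Psi>(2)) (simp add: join_def)
      then show ?thesis
        by (rule halts_transfer)
          (use False \<psi>(2) in simp)
    qed
  qed
qed

text \<open>The state of the simulation consists of the history \<open>\<tau>\<close> of the outer computation, the history
  \<open>\<rho>\<close> of the inner computation that answers the current query of the outer one (empty if the outer
  computation is to move), and the oracle answers not consumed so far. The simulation is restarted
  from its input for each new oracle answer.\<close>

lemma subT_le_trans:
  assumes "f \<le>\<^sub>s\<^sub>u\<^sub>b\<^sub>T g" "g \<le>\<^sub>s\<^sub>u\<^sub>b\<^sub>T h"
  shows "f \<le>\<^sub>s\<^sub>u\<^sub>b\<^sub>T h"
proof -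
  obtain \<Phi> where \<Phi>: "seq_computable \<Phi>" "\<And>n y. f n = Some y \<Longrightarrow> halts \<Phi> g [n] y"
    using assms(1) by (rule subT_leE) blast
  obtain \<phi> where \<phi>: "partial_computable \<phi>"
    "\<And>\<sigma>. \<phi> (list_encode \<sigma>) = map_option (\<lambda>(b, q). prod_encode (of_bool b, q)) (\<Phi> \<sigma>)"
    using \<Phi>(1) by (rule seq_computableE) blast
  obtain \<Psi> where \<Psi>: "seq_computable \<Psi>" "\<And>n y. g n = Some y \<Longrightarrow> halts \<Psi> h [n] y"
    using assms(2) by (rule subT_leE) blast
  obtain \<psi> where \<psi>: "partial_computable \<psi>"
    "\<And>\<sigma>. \<psi> (list_encode \<sigma>) = map_option (\<lambda>(b, q). prod_encode (of_bool b, q)) (\<Psi> \<sigma>)"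
    using \<Psi>(1) by (rule seq_computableE) blast
  \<comment> \<open>Two tags are in play: the one added here controls the loop, while a returned
    \<open>r\<close> keeps its own, which tells whether the combined program asks or halts.\<close>
  define outer where "outer s r = (if pfst r = 0
      then prod_encode (0, prod_encode (pfst s,
        prod_encode (Suc (prod_encode (psnd r, 0)), psnd (psnd s))))
      else prod_encode (1, r))" for s r
  define inner where "inner s r = (if pfst r = 0
      then if psnd (psnd s) = 0 then prod_encode (1, r)
        else prod_encode (0, prod_encode (pfst s, prod_encode
          (list_encode (list_decode (pfst (psnd s)) @ [pfst (psnd (psnd s) - 1)]),
           psnd (psnd (psnd s) - 1))))
      else prod_encode (0, prod_encode (list_encode (list_decode (pfst s) @ [psnd r]),
        prod_encode (0, psnd (psnd s)))))" for s r
  define \<theta> where "\<theta> s = (if pfst (psnd s) = 0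
      then Option.bind (\<phi> (pfst s)) (\<lambda>r. Some (outer s r))
      else Option.bind (\<psi> (pfst (psnd s))) (\<lambda>r. Some (inner s r)))" for s
  have "partial_computable \<theta>"
    unfolding \<theta>_def outer_def inner_def
    by (intro computable partial_computable_app [OF \<phi>(1)] partial_computable_app [OF \<psi>(1)])
  then obtain P where P: "partial_computable P"
    "\<And>s z. \<theta> s = Some z \<Longrightarrow> P s = (if pfst z = 0 then P (psnd z) else Some (psnd z))"
    by (rule partial_computable_loop) blast
  have stop: "P s = Some r" if "\<theta> s = Some (prod_encode (1, r))" for s r
    using P(2) [OF that] by simp
  have continue: "P s = P s'" if "\<theta> s = Some (prod_encode (0, s'))" for s s'
    using P(2) [OF that] by simp
  define sim where "sim \<tau> \<rho> zs =
    P (prod_encode (list_encode \<tau>, prod_encode (list_encode \<rho>, list_encode zs)))" for \<tau> \<rho> zs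
  have outer_halt: "sim \<tau> [] zs = Some (prod_encode (1, y))" if "\<Phi> \<tau> = Some (True, y)" for \<tau> zs y
    unfolding sim_def by (rule stop) (simp add: \<theta>_def outer_def \<phi>(2) that)
  have outer_query: "sim \<tau> [] zs = sim \<tau> [q] zs" if "\<Phi> \<tau> = Some (False, q)" for \<tau> zs q
    unfolding sim_def by (rule continue) (simp add: \<theta>_def outer_def \<phi>(2) that)
  have inner_halt: "sim \<tau> \<rho> zs = sim (\<tau> @ [a]) [] zs"
    if "\<Psi> \<rho> = Some (True, a)" "\<rho> \<noteq> []" for \<tau> \<rho> zs a
    unfolding sim_def by (rule continue) (simp add: \<theta>_def inner_def \<psi>(2) that list_encode_eq_0_iff)
  have inner_wait: "sim \<tau> \<rho> [] = Some (prod_encode (0, q))"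
    if "\<Psi> \<rho> = Some (False, q)" "\<rho> \<noteq> []" for \<tau> \<rho> q
    unfolding sim_def by (rule stop) (simp add: \<theta>_def inner_def \<psi>(2) that list_encode_eq_0_iff)
  have inner_query: "sim \<tau> \<rho> (a # zs) = sim \<tau> (\<rho> @ [a]) zs"
    if "\<Psi> \<rho> = Some (False, q)" "\<rho> \<noteq> []" for \<tau> \<rho> q a zs
    unfolding sim_def by (rule continue) (simp add: \<theta>_def inner_def \<psi>(2) that list_encode_eq_0_iff)
  let ?\<chi> = "\<lambda>x. P (prod_encode (Suc (prod_encode (pfst (x - 1), 0)), prod_encode (0, psnd (x - 1))))"
  define X where "X \<sigma> = map_option (\<lambda>z. (pfst z \<noteq> 0, psnd z)) (?\<chi> (list_encode \<sigma>))" for \<sigma>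
  have X: "X (n # as) = map_option (\<lambda>z. (pfst z \<noteq> 0, psnd z)) (sim [n] [] as)" for n as
    by (simp add: X_def sim_def)
  \<comment> \<open>Invariant: the answers \<open>as\<close> bring the simulation exactly to
    \<open>\<tau>\<close>, \<open>\<rho>\<close>, whatever answers \<open>zs\<close> follow. The
    last premise is the continuation of the outer run once the inner one has delivered
    \<open>a\<close>.\<close>
  have inner: "halts X h (n # as) y"
    if "halts \<Psi> h \<rho> a" "\<rho> \<noteq> []" "\<And>zs. sim [n] [] (as @ zs) = sim \<tau> \<rho> zs"
      "\<And>as'. (\<And>zs. sim [n] [] (as' @ zs) = sim (\<tau> @ [a]) [] zs) \<Longrightarrow> halts X h (n # as') y"
    for \<rho> a n as \<tau> y
    using that
  proof (induction arbitrary: as rule: halts.induct)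
    case (answer \<rho> a)
    show ?case by (rule answer.prems(3)) (simp add: answer inner_halt)
  next
    case (query \<rho> q b a)
    have "halts X h (n # (as @ [b])) y"
      by (rule query.IH) (simp_all add: query.prems inner_query [OF query.hyps(1)])
    moreover have "X (n # as) = Some (False, q)"
      using query.prems(2) [of "[]"] inner_wait [OF query.hyps(1)] query.prems(1) by (simp add: X)
    ultimately show ?case using query.hyps(2) by (auto intro: halts.query)
  qed
  have outer: "halts X h (n # as) y"
    if "halts \<Phi> g \<tau> y" "\<And>zs. sim [n] [] (as @ zs) = sim \<tau> [] zs" for \<tau> y n as
    using that
  proof (induction arbitrary: as rule: halts.induct)
    case (answer \<tau> y)
    then show ?case
      using answer.prems [of "[]"] outer_halt [OF answer.hyps] by (intro halts.answer) (simp add: X)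
  next
    case (query \<tau> q a y)
    show ?case
    proof (rule inner [OF \<Psi>(2) [OF query.hyps(2)]])
      show "sim [n] [] (as @ zs) = sim \<tau> [q] zs" for zs
        by (simp add: query.prems outer_query [OF query.hyps(1)])
    qed (simp, rule query.IH)
  qed
  show ?thesis
  proof (rule subT_leI)
    show "seq_computable X"
    proof (rule seq_computableI)
      show "partial_computable ?\<chi>" by (intro partial_computable_app [OF P(1)] computable)
    qed (rule X_def)
    show "halts X h [n] y" if "f n = Some y" for n y
      by (rule outer [OF \<Phi>(2) [OF that]]) simp
  qed
qed

text \<open>The points of \<open>E\<close> are put back one by one with \<open>subT_le_upd\<close>;
  those outside \<open>dom f\<close> change nothing.\<close>

lemma subT_le_if_finite_diff:
  assumes "finite E" "f |` (- E) \<le>\<^sub>s\<^sub>u\<^sub>b\<^sub>T g"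
  shows "f \<le>\<^sub>s\<^sub>u\<^sub>b\<^sub>T g"
  using assms
proof (induction E rule: finite_induct)
  case empty
  then show ?case by simp
next
  case (insert c E)
  have "f |` (- E) \<le>\<^sub>s\<^sub>u\<^sub>b\<^sub>T g"
  proof (cases "f c")
    case None
    then have "f |` (- E) = f |` (- insert c E)" by (auto simp: restrict_map_def)
    with insert.prems show ?thesis by simp
  next
    case (Some v)
    then have "f |` (- E) = (f |` (- insert c E))(c \<mapsto> v)"
      using insert.hyps by (auto simp: restrict_map_def)
    with subT_le_upd [OF insert.prems] show ?thesis by simp
  qed
  then show ?case by (rule insert.IH)
qed

lemma join_finite_subT_le:
  assumes "finite A"
  shows "join g (f |` A) \<le>\<^sub>s\<^sub>u\<^sub>b\<^sub>T g"
proof (rule join_subT_le)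
  show "g \<le>\<^sub>s\<^sub>u\<^sub>b\<^sub>T g" by (rule subT_le_if_map_le) simp
  show "f |` A \<le>\<^sub>s\<^sub>u\<^sub>b\<^sub>T g"
    by (rule subT_le_if_finite_diff [OF assms], rule subT_le_if_map_le) (simp add: map_le_def)
qed

section \<open>Density\<close>

lemma avoid_reduction_of_restriction:
  assumes "\<not> f \<le>\<^sub>s\<^sub>u\<^sub>b\<^sub>T g" "finite E" "seq_computable \<Phi>"
  obtains n where "n \<notin> E" "\<And>D. n \<in> D \<Longrightarrow> \<not> f |` D \<subseteq>\<^sub>m seq_comp \<Phi> g"
proof -
  have "\<not> f |` (- E) \<le>\<^sub>s\<^sub>u\<^sub>b\<^sub>T g" using assms(1,2) subT_le_if_finite_diff by blast
  then obtain n y where "(f |` (- E)) n = Some y" "\<not> halts \<Phi> g [n] y"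
    using subT_leI assms(3) by metis
  then have "n \<notin> E" "f n = Some y" "\<not> halts \<Phi> g [n] y"
    by (auto simp: restrict_map_def split: if_splits)
  then show ?thesis by (intro that [of n]) (simp_all add: map_le_seq_comp_iff, metis restrict_in)
qed

text \<open>Any oracle below \<open>H\<close> with which the computation succeeds must follow the
  run with \<open>H\<close>, query by query. The first query on that run outside
  \<open>dom K\<close> is therefore indispensable.\<close>

lemma halts_restriction_or_needs_query:
  assumes "halts \<Phi> H \<sigma> y" "K \<subseteq>\<^sub>m H" "\<not> halts \<Phi> K \<sigma> y"
  shows "\<exists>q. q \<in> dom H - dom K \<and> (\<forall>K'. K' \<subseteq>\<^sub>m H \<longrightarrow> q \<notin> dom K' \<longrightarrow> \<not> halts \<Phi> K' \<sigma> y)"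
  using assms
proof (induction rule: halts.induct)
  case (answer \<sigma> y)
  then show ?case by (auto intro: halts.answer)
next
  case (query \<sigma> q a y)
  have next_state: "K' q = Some a \<and> halts \<Phi> K' (\<sigma> @ [a]) y"
    if K': "K' \<subseteq>\<^sub>m H" "halts \<Phi> K' \<sigma> y" for K'
  proof -
    obtain b where b: "K' q = Some b" "halts \<Phi> K' (\<sigma> @ [b]) y"
      using K'(2) query.hyps(1) by (rule halts_queryD)
    then have "b = a" using K'(1) query.hyps(2) by (force simp: map_le_def dom_def)
    with b show ?thesis by simp
  qed
  show ?case
  proof (cases "q \<in> dom K")
    case False
    then show ?thesis using next_state query.hyps(2) by blast
  next
    case True
    then have "K q = Some a" using query.prems(1) query.hyps(2) by (force simp: map_le_def)
    then have "\<not> halts \<Phi> K (\<sigma> @ [a]) y" using query.prems(2) query.hyps(1) by (auto intro: halts.query)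
    then show ?thesis using query.IH [OF query.prems(1)] next_state by blast
  qed
qed

lemma join_map_le: "f \<subseteq>\<^sub>m f' \<Longrightarrow> join g f \<subseteq>\<^sub>m join g f'"
  by (auto simp: map_le_def join_def dom_def)

lemma avoid_reduction_to_join:
  assumes "\<not> f \<le>\<^sub>s\<^sub>u\<^sub>b\<^sub>T g" "finite A" "finite E" "A \<inter> E = {}" "seq_computable \<Phi>"
  obtains E' where "finite E'" "E \<subseteq> E'" "A \<inter> E' = {}"
    "\<And>D. D \<inter> E' = {} \<Longrightarrow> \<not> f \<subseteq>\<^sub>m seq_comp \<Phi> (join g (f |` D))"
proof -
  let ?H = "join g (f |` (- E))" and ?K = "join g (f |` A)"
  have "\<not> f \<le>\<^sub>s\<^sub>u\<^sub>b\<^sub>T ?K" using subT_le_trans join_finite_subT_le assms(1,2) by blast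
  then obtain n y where n: "f n = Some y" "\<not> halts \<Phi> ?K [n] y"
    using subT_leI assms(5) by metis
  have mono: "join g (f |` D) \<subseteq>\<^sub>m ?H" if "D \<inter> E = {}" for D
    using that by (intro join_map_le) (auto simp: map_le_def restrict_map_def split: if_splits)
  show ?thesis
  proof (cases "halts \<Phi> ?H [n] y")
    \<comment> \<open>If even \<open>?H\<close> fails, every smaller oracle fails and nothing more
      need be barred.\<close>
    case False
    then show ?thesis using n halts_mono [OF _ mono] assms(3,4)
      by (intro that [of E]) (simp_all add: map_le_seq_comp_iff, metis)
  next
    case True
    then obtain q where q: "q \<in> dom ?H - dom ?K"
      "\<And>K'. K' \<subseteq>\<^sub>m ?H \<Longrightarrow> q \<notin> dom K' \<Longrightarrow> \<not> halts \<Phi> K' [n] y"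
      using halts_restriction_or_needs_query [OF True mono [OF assms(4)] n(2)] by blast
    \<comment> \<open>Both oracles agree on the side of \<open>g\<close>, so \<open>q\<close> asks
      for a value of \<open>f\<close> at a point not in \<open>A\<close>; that point may be
      barred.\<close>
    have pq: "pfst q \<noteq> 0" "psnd q \<notin> A"
      using q(1) by (auto simp: join_def restrict_map_def split: if_splits)
    show ?thesis
    proof (rule that [of "insert (psnd q) E"])
      fix D assume D: "D \<inter> insert (psnd q) E = {}"
      then have "q \<notin> dom (join g (f |` D))" using pq by (auto simp: join_def)
      then have "\<not> halts \<Phi> (join g (f |` D)) [n] y" using q(2) mono D by blast
      then show "\<not> f \<subseteq>\<^sub>m seq_comp \<Phi> (join g (f |` D))" using n by (auto simp: map_le_seq_comp_iff)
    qed (use assms pq in auto)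
  qed
qed

lemma generic_restriction:
  assumes "\<not> f \<le>\<^sub>s\<^sub>u\<^sub>b\<^sub>T g"
  obtains D where "\<not> f |` D \<le>\<^sub>s\<^sub>u\<^sub>b\<^sub>T g" "\<not> f \<le>\<^sub>s\<^sub>u\<^sub>b\<^sub>T join g (f |` D)"
proof -
  let ?C = "{\<Phi>. seq_computable \<Phi>}"
  \<comment> \<open>\<open>from_nat_into\<close> is onto only for nonempty sets; a member comes from
    reflexivity.\<close>
  have "?C \<noteq> {}" using subT_leE [OF subT_le_if_map_le [OF map_le_refl]] by blast
  then have range: "range (from_nat_into ?C) = ?C"
    using countable_seq_computable by (rule range_from_nat_into)
  then have comp: "seq_computable (from_nat_into ?C e)" for e by blast
  define met where "met e D \<longleftrightarrow> \<not> f |` D \<subseteq>\<^sub>m seq_comp (from_nat_into ?C e) g \<and>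
    \<not> f \<subseteq>\<^sub>m seq_comp (from_nat_into ?C e) (join g (f |` D))" for e D
  define ok where "ok c \<longleftrightarrow> finite (fst c) \<and> finite (snd c) \<and> fst c \<inter> snd c = {}"
    for c :: "nat set \<times> nat set"
  \<comment> \<open>Quantifying over all sets compatible with \<open>c'\<close> makes what stage
    \<open>e\<close> achieves immune to later stages.\<close>
  define ext where "ext e c c' \<longleftrightarrow> fst c \<subseteq> fst c' \<and> snd c \<subseteq> snd c' \<and>
    (\<forall>D. fst c' \<subseteq> D \<longrightarrow> D \<inter> snd c' = {} \<longrightarrow> met e D)" for e c c'
  have "\<exists>c. \<forall>e. ok (c e) \<and> ext e (c e) (c (Suc e))"
  proof (rule dependent_nat_choice)
    show "\<exists>c. ok c" by (rule exI [of _ "({}, {})"]) (simp add: ok_def)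
  next
    fix c e assume "ok c"
    then obtain A E where c: "c = (A, E)" "finite A" "finite E" "A \<inter> E = {}"
      by (cases c) (auto simp: ok_def)
    obtain n where n: "n \<notin> E" "\<And>D. n \<in> D \<Longrightarrow> \<not> f |` D \<subseteq>\<^sub>m seq_comp (from_nat_into ?C e) g"
      using avoid_reduction_of_restriction [OF assms c(3) comp] by blast
    have "finite (insert n A)" "insert n A \<inter> E = {}" using c n(1) by auto
    then obtain E' where "finite E'" "E \<subseteq> E'" "insert n A \<inter> E' = {}"
      "\<And>D. D \<inter> E' = {} \<Longrightarrow> \<not> f \<subseteq>\<^sub>m seq_comp (from_nat_into ?C e) (join g (f |` D))"
      using avoid_reduction_to_join [OF assms _ c(3) _ comp] by metis
    with n c have "ok (insert n A, E') \<and> ext e c (insert n A, E')"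
      by (auto simp: ok_def ext_def met_def)
    then show "\<exists>c'. ok c' \<and> ext e c c'" by blast
  qed
  then obtain c where c: "\<And>e. ok (c e)" "\<And>e. ext e (c e) (c (Suc e))" by blast
  define A where "A e = fst (c e)" for e
  define E where "E e = snd (c e)" for e
  have disj: "A e \<inter> E e = {}" for e using c(1) [of e] by (simp add: A_def E_def ok_def)
  have step: "A e \<subseteq> A (Suc e)" "E e \<subseteq> E (Suc e)"
    "A (Suc e) \<subseteq> D \<Longrightarrow> D \<inter> E (Suc e) = {} \<Longrightarrow> met e D" for e D
    using c(2) [of e] by (simp_all add: A_def E_def ext_def)
  have mono: "A i \<subseteq> A j" "E i \<subseteq> E j" if "i \<le> j" for i j
    using lift_Suc_mono_le [of A] lift_Suc_mono_le [of E] step that by blast+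
  let ?D = "\<Union>e. A e"
  have "A i \<inter> E e = {}" for i e
    using disj [of "max i e"] mono(1) [of i "max i e"] mono(2) [of e "max i e"] by auto
  then have met: "met e ?D" for e by (intro step(3)) blast+
  have "\<not> f |` ?D \<subseteq>\<^sub>m seq_comp \<Phi> g \<and> \<not> f \<subseteq>\<^sub>m seq_comp \<Phi> (join g (f |` ?D))"
    if "seq_computable \<Phi>" for \<Phi>
  proof -
    have "\<Phi> \<in> range (from_nat_into ?C)" unfolding range using that by simp
    then obtain e where "\<Phi> = from_nat_into ?C e" by (rule rangeE)
    then show ?thesis using met [of e] by (simp add: met_def)
  qed
  then show ?thesis by (intro that [of ?D]) (auto simp: subT_le_def)
qed

theorem theorem4p1:
  fixes f g :: "nat \<rightharpoonup> nat"
  assumes "g <\<^sub>s\<^sub>u\<^sub>b\<^sub>T f"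
  shows "\<exists>h :: nat \<rightharpoonup> nat. g <\<^sub>s\<^sub>u\<^sub>b\<^sub>T h \<and> h <\<^sub>s\<^sub>u\<^sub>b\<^sub>T f"
proof -
  have gf: "g \<le>\<^sub>s\<^sub>u\<^sub>b\<^sub>T f" and fg: "\<not> f \<le>\<^sub>s\<^sub>u\<^sub>b\<^sub>T g" using assms by (auto simp: subT_less_def)
  obtain D where D: "\<not> f |` D \<le>\<^sub>s\<^sub>u\<^sub>b\<^sub>T g" "\<not> f \<le>\<^sub>s\<^sub>u\<^sub>b\<^sub>T join g (f |` D)"
    using fg by (rule generic_restriction)
  have "f |` D \<le>\<^sub>s\<^sub>u\<^sub>b\<^sub>T f"
    by (rule subT_le_if_map_le) (auto simp: map_le_def restrict_map_def split: if_splits)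
  then have "join g (f |` D) \<le>\<^sub>s\<^sub>u\<^sub>b\<^sub>T f" using gf by (intro join_subT_le)
  moreover have "\<not> join g (f |` D) \<le>\<^sub>s\<^sub>u\<^sub>b\<^sub>T g" using D(1) subT_le_join2 subT_le_trans by blast
  ultimately show ?thesis using D(2) subT_le_join1 unfolding subT_less_def by blast
qed

end
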